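(* Let $r \ge 2$ be an integer, and let $E$ be the (finite) set of edges of some $r$-uniform hypergraph on a finite vertex set $V$. Let $\mathbf{a} = \{a_e\}_{e\in E}$ and $\mathbf{b} = \{b_v\}_{v\in V}$ be systems of positive real weights, and write $\underline{a} = \min_{e\in E} a_e$ and $\underline{b} = \min_{v \in V} b_v$. Let $n > \underline{a}\,\underline{b}$ be a real number. Then the simplicial complex $X = \{E' \subseteq E:\ \nu^*_{\mathbf{a},\mathbf{b}}(E') < n\}$ on the vertex set $E$ is $\left(\lceil \frac{rn}{\underline{a}\,\underline{b}} \rceil - 1\right)$-collapsible.
   Context: For $E' \subseteq E$, $\nu^*_{\mathbf{a},\mathbf{b}}(E')$ is the maximum of $\sum_{e\in E'} a_e f(e)$ over all $f\colon E'\to\mathbb{R}$ with $f(e)\ge 0$ for all $e\in E'$ and $\sum_{e\in E',\, e\ni v} f(e) \le b_v$ for all $v\in V$. A simplicial complex is a family of subsets closed under taking subsets; a facet is an inclusion-maximal face. For a positive integer $d$: if $\sigma$ is a face of $X$ contained in a unique facet of $X$ and $|\sigma| \le d$, removing $\sigma$ and all faces containing it is an elementary $d$-collapse; $X$ is $d$-collapsible if a finite sequence of elementary $d$-collapses reduces $X$ to $\{\emptyset\}$. *)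

theory Defs
  imports "HOL-Analysis.Analysis"
begin

definition uniform_hypergraph :: "nat \<Rightarrow> 'v set \<Rightarrow> 'v set set \<Rightarrow> bool" where
  "uniform_hypergraph r V E \<longleftrightarrow> finite V \<and> (\<forall>e\<in>E. e \<subseteq> V \<and> card e = r)"

text \<open>
  A weight \<open>f\<close> on the edges is total here; only its values on \<open>F\<close> are constrained,
  and only these enter the objective.
\<close>

definition feasible :: "'v set \<Rightarrow> ('v \<Rightarrow> real) \<Rightarrow> 'v set set \<Rightarrow> ('v set \<Rightarrow> real) \<Rightarrow> bool" where
  "feasible V b F f \<longleftrightarrow>
     (\<forall>e\<in>F. 0 \<le> f e) \<and> (\<forall>v\<in>V. (\<Sum>e\<in>{e\<in>F. v \<in> e}. f e) \<le> b v)"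

text \<open>
  The supremum is a maximum under the hypotheses of lemma \<open>nu_star_attained\<close> below,
  which hold for every set of edges of a uniform hypergraph with nonempty edges
  and nonnegative vertex weights.
\<close>

definition nu_star ::
  "'v set \<Rightarrow> ('v set \<Rightarrow> real) \<Rightarrow> ('v \<Rightarrow> real) \<Rightarrow> 'v set set \<Rightarrow> real" where
  "nu_star V a b F = Sup {(\<Sum>e\<in>F. a e * f e) |f. feasible V b F f}"

lemma nu_star_attained:
  fixes b :: "'v \<Rightarrow> real"
  assumes fin: "finite F" and ne: "\<And>e. e \<in> F \<Longrightarrow> e \<inter> V \<noteq> {}"
    and b: "\<And>v. v \<in> V \<Longrightarrow> 0 \<le> b v"
  obtains f where "feasible V b F f" "(\<Sum>e\<in>F. a e * f e) = nu_star V a b F"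
    "\<And>g. feasible V b F g \<Longrightarrow> (\<Sum>e\<in>F. a e * g e) \<le> nu_star V a b F"
proof -
  define w where "w e = (SOME v. v \<in> e \<inter> V)" for e
  have w: "w e \<in> e \<inter> V" if "e \<in> F" for e
    unfolding w_def using ne[OF that] by (intro some_in_eq[THEN iffD2])
  define K :: "('v set \<Rightarrow> real) set"
    where "K = PiE UNIV (\<lambda>e. if e \<in> F then {0..b (w e)} else {0})"
  define S where "S = K \<inter> {f. \<forall>v\<in>V. (\<Sum>e\<in>{e\<in>F. v \<in> e}. f e) \<le> b v}"
  have bound: "g e \<le> b (w e)" if "feasible V b F g" "e \<in> F" for g e
  proof -
    have "g e \<le> (\<Sum>e'\<in>{e'\<in>F. w e \<in> e'}. g e')"
      using that w[of e] fin by (intro member_le_sum) (auto simp: feasible_def)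
    also have "\<dots> \<le> b (w e)"
      using that w[of e] by (auto simp: feasible_def)
    finally show ?thesis .
  qed
  have "compactin (product_topology (\<lambda>_. euclidean) UNIV) K"
    unfolding K_def by (subst compactin_PiE) auto
  hence "compact K"
    by (simp add: euclidean_product_topology)
  moreover have coord: "continuous_on UNIV (\<lambda>f::'v set \<Rightarrow> real. f e)" for e
    by (rule continuous_on_product_coordinates)
  hence "closed {f::'v set \<Rightarrow> real. (\<Sum>e\<in>{e\<in>F. v \<in> e}. f e) \<le> b v}" for v
    by (intro closed_Collect_le continuous_on_sum continuous_on_const) auto
  hence "closed {f. \<forall>v\<in>V. (\<Sum>e\<in>{e\<in>F. v \<in> e}. f e) \<le> b v}"
    unfolding Ball_def by (intro closed_Collect_all closed_Collect_imp) auto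
  ultimately have "compact S"
    unfolding S_def by (intro compact_Int_closed)
  moreover have "(\<lambda>_. 0) \<in> S"
    using w b by (auto simp: S_def K_def PiE_def Pi_def)
  moreover have "continuous_on S (\<lambda>f. \<Sum>e\<in>F. a e * f e)"
    using coord
    by (intro continuous_on_sum continuous_on_mult continuous_on_const)
       (blast intro: continuous_on_subset)
  ultimately obtain f where f: "f \<in> S"
    and max: "\<And>g. g \<in> S \<Longrightarrow> (\<Sum>e\<in>F. a e * g e) \<le> (\<Sum>e\<in>F. a e * f e)"
    using continuous_attains_sup[of S "\<lambda>f. \<Sum>e\<in>F. a e * f e"] by auto
  have feas: "feasible V b F f"
    unfolding feasible_def
  proof (intro conjI ballI)
    fix e assume "e \<in> F"
    thus "0 \<le> f e" using f by (auto simp: S_def K_def PiE_def Pi_def dest: spec[of _ e])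
  qed (use f in \<open>auto simp: S_def\<close>)
  have le: "(\<Sum>e\<in>F. a e * g e) \<le> (\<Sum>e\<in>F. a e * f e)" if g: "feasible V b F g" for g
  proof -
    define h where "h e = (if e \<in> F then g e else 0)" for e
    have "(\<Sum>e\<in>{e\<in>F. v \<in> e}. h e) = (\<Sum>e\<in>{e\<in>F. v \<in> e}. g e)" for v
      by (intro sum.cong) (auto simp: h_def)
    hence "h \<in> S"
      using g bound[OF g] by (auto simp: S_def K_def h_def feasible_def)
    hence "(\<Sum>e\<in>F. a e * h e) \<le> (\<Sum>e\<in>F. a e * f e)" by (rule max)
    thus ?thesis by (simp add: h_def cong: sum.cong)
  qed
  have "nu_star V a b F = (\<Sum>e\<in>F. a e * f e)"
    unfolding nu_star_def using feas le by (intro cSup_eq_maximum) auto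
  with feas le show thesis by (intro that) auto
qed

definition simplicial_complex :: "'a set set \<Rightarrow> bool" where
  "simplicial_complex X \<longleftrightarrow> (\<forall>\<sigma>\<in>X. \<forall>\<tau>. \<tau> \<subseteq> \<sigma> \<longrightarrow> \<tau> \<in> X)"

definition facet :: "'a set set \<Rightarrow> 'a set \<Rightarrow> bool" where
  "facet X \<tau> \<longleftrightarrow> \<tau> \<in> X \<and> (\<forall>\<rho>\<in>X. \<tau> \<subseteq> \<rho> \<longrightarrow> \<rho> = \<tau>)"

definition elementary_collapse :: "nat \<Rightarrow> 'a set set \<Rightarrow> 'a set set \<Rightarrow> bool" where
  "elementary_collapse d X Y \<longleftrightarrow>
     (\<exists>\<sigma>\<in>X. finite \<sigma> \<and> card \<sigma> \<le> d \<and> (\<exists>!\<tau>. facet X \<tau> \<and> \<sigma> \<subseteq> \<tau>) \<and>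
        Y = {\<rho>\<in>X. \<not> \<sigma> \<subseteq> \<rho>})"

definition collapsible :: "nat \<Rightarrow> 'a set set \<Rightarrow> bool" where
  "collapsible d X \<longleftrightarrow> simplicial_complex X \<and> (elementary_collapse d)\<^sup>*\<^sup>* X {{}}"

end

theory Submission
  imports Defs
begin

text \<open>
  Raise the weights \<open>b\<close> and then \<open>a\<close> slightly, to generic values; the complex does not change
  and the bound on the dimension only improves. Every \<open>F\<close> now has a unique optimal fractional
  matching \<open>f\<close>, distinct optimal matchings have distinct values, and the vertices \<open>S\<close> saturated by
  \<open>f\<close> together with the support \<open>\<sigma>\<close> of \<open>f\<close> span a nonsingular square submatrix of the incidence
  matrix. Solving the transposed system gives a dual optimum \<open>w\<close> that depends on \<open>f\<close> only. Hence
  the sets with the same value of \<open>\<nu>*\<close> as \<open>F\<close> form the interval from \<open>\<sigma>\<close> to the set of all edges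
  covered by \<open>w\<close>, and the faces can be removed level by level, in decreasing order of \<open>\<nu>*\<close>, each
  level by a single collapse of \<open>\<sigma>\<close>. Finally \<open>|\<sigma>| = |S|\<close>, and counting incidences bounds
  \<open>|S| \<cdot> min b\<close> by \<open>r \<Sum> f(e) < r n / min a\<close>.
\<close>

section \<open>Linear algebra over finite index sets\<close>

text \<open>Hyperplanes are dodged one at a time: a new form is made nonzero by raising one
  coordinate on which it has a nonzero coefficient, by an amount that spares the earlier forms.
  Since coordinates only move up, the box may include its lower corner.\<close>

lemma avoid_hyperplanes:
  fixes l u :: "'i \<Rightarrow> real"
  assumes "finite C" "finite I" "\<And>i. i \<in> I \<Longrightarrow> l i < u i"
    and "\<And>c. c \<in> C \<Longrightarrow> \<exists>i\<in>I. c i \<noteq> 0"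
  shows "\<exists>x. (\<forall>i\<in>I. l i \<le> x i \<and> x i < u i) \<and> (\<forall>c\<in>C. (\<Sum>i\<in>I. c i * x i) \<noteq> 0)"
  using assms(1,4)
proof (induction C rule: finite_induct)
  case empty
  then show ?case using assms(3) by (intro exI[of _ l]) auto
next
  case (insert c C)
  then obtain x where x: "\<And>i. i \<in> I \<Longrightarrow> l i \<le> x i \<and> x i < u i"
    and ne: "\<And>c. c \<in> C \<Longrightarrow> (\<Sum>i\<in>I. c i * x i) \<noteq> 0" by auto
  obtain i where i: "i \<in> I" "c i \<noteq> 0" using insert.prems by auto
  \<comment> \<open>The finitely many increments of coordinate \<open>i\<close> at which some form
    vanishes. A form with \<open>c' i = 0\<close> contributes only the value 0 of a division by
    zero, which lies outside the open interval.\<close>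
  define B where "B = (\<lambda>c'. - (\<Sum>j\<in>I. c' j * x j) / c' i) ` insert c C"
  have "infinite {0<..<u i - x i}"
    using x[OF i(1)] by simp
  moreover have "finite B" using insert.hyps by (simp add: B_def)
  ultimately have "infinite ({0<..<u i - x i} - B)" by simp
  then obtain t where t: "t \<in> {0<..<u i - x i} - B"
    using infinite_imp_nonempty by blast
  define y where "y = x(i := x i + t)"
  have sum: "(\<Sum>j\<in>I. c' j * y j) = (\<Sum>j\<in>I. c' j * x j) + t * c' i" for c' :: "'i \<Rightarrow> real"
  proof -
    have "(\<Sum>j\<in>I. c' j * y j) = (\<Sum>j\<in>I. c' j * x j + (if j = i then t * c' i else 0))"
      by (intro sum.cong) (auto simp: y_def algebra_simps)
    then show ?thesis using i assms(2) by (simp add: sum.distrib)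
  qed
  have "(\<Sum>j\<in>I. c' j * y j) \<noteq> 0" if c': "c' \<in> insert c C" for c'
  proof (cases "c' i = 0")
    case True
    then show ?thesis using c' i ne sum[of c'] by auto
  next
    case False
    have "t \<noteq> - (\<Sum>j\<in>I. c' j * x j) / c' i" using t c' by (auto simp: B_def)
    then show ?thesis using False sum[of c'] by (auto simp: field_simps)
  qed
  moreover have "\<forall>j\<in>I. l j \<le> y j \<and> y j < u j"
    using x t i by (force simp: y_def)
  ultimately show ?case by blast
qed

text \<open>An injective matrix has a surjective transpose and at least as many rows as columns.
  Gaussian elimination on the rows: a zero row is dropped, and any other row is removed together
  with a pivot column.\<close>

lemma trivial_kernel_imp_transpose_onto:
  fixes M :: "'i \<Rightarrow> 'j \<Rightarrow> real"
  assumes "finite I" "finite J"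
    and "\<And>h j. (\<And>i. i \<in> I \<Longrightarrow> (\<Sum>j\<in>J. M i j * h j) = 0) \<Longrightarrow> j \<in> J \<Longrightarrow> h j = 0"
  shows "card J \<le> card I \<and> (\<forall>y. \<exists>w. \<forall>j\<in>J. (\<Sum>i\<in>I. w i * M i j) = y j)"
  using assms
proof (induction I arbitrary: J M rule: finite_induct)
  case empty
  have "j \<notin> J" for j using empty.prems(2)[of "\<lambda>_. 1"] by fastforce
  then have "J = {}" by auto
  then show ?case by simp
next
  case (insert i I)
  show ?case
  proof (cases "\<forall>j\<in>J. M i j = 0")
    case True
    have IH: "card J \<le> card I \<and> (\<forall>y. \<exists>w. \<forall>j\<in>J. (\<Sum>i\<in>I. w i * M i j) = y j)"
    proof (rule insert.IH[OF insert.prems(1)])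
      fix h j assume "\<And>k. k \<in> I \<Longrightarrow> (\<Sum>j\<in>J. M k j * h j) = 0" "j \<in> J"
      then show "h j = 0" using True by (intro insert.prems(2)[of h]) auto
    qed
    then show ?thesis using insert.hyps True by auto
  next
    case False
    then obtain j0 where j0: "j0 \<in> J" "M i j0 \<noteq> 0" by blast
    \<comment> \<open>The Schur complement of the pivot: row \<open>k\<close> minus the multiple of
      row \<open>i\<close> that clears column \<open>j0\<close>.\<close>
    define M' where "M' k j = M k j - M k j0 * M i j / M i j0" for k j
    define J' where "J' = J - {j0}"
    have J': "finite J'" and split: "(\<Sum>j\<in>J. g j) = g j0 + (\<Sum>j\<in>J'. g j)" for g :: "'j \<Rightarrow> real"
      using insert.prems(1) j0 by (auto simp: J'_def sum.remove)
    have IH: "card J' \<le> card I \<and> (\<forall>y. \<exists>w. \<forall>j\<in>J'. (\<Sum>i\<in>I. w i * M' i j) = y j)"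
    proof (rule insert.IH[OF J'])
      fix h j assume h: "\<And>k. k \<in> I \<Longrightarrow> (\<Sum>j\<in>J'. M' k j * h j) = 0" and j: "j \<in> J'"
      define s where "s = (\<Sum>j\<in>J'. M i j * h j)"
      \<comment> \<open>The value at \<open>j0\<close> is chosen so that row \<open>i\<close>
        annihilates \<open>h'\<close>; the other rows of \<open>M\<close> then act on
        \<open>h'\<close> as those of \<open>M'\<close> act on \<open>h\<close>.\<close>
      define h' where "h' = h(j0 := - s / M i j0)"
      have on: "(\<Sum>j\<in>J'. M k j * h' j) = (\<Sum>j\<in>J'. M k j * h j)" for k
        by (intro sum.cong) (auto simp: h'_def J'_def)
      have "(\<Sum>j\<in>J. M k j * h' j) = 0" if "k \<in> insert i I" for k
      proof (cases "k = i")
        case True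
        then show ?thesis using j0 by (simp add: split on) (simp add: h'_def s_def)
      next
        case False
        then have "0 = (\<Sum>j\<in>J'. M' k j * h j)" using h that by auto
        also have "\<dots> = (\<Sum>j\<in>J'. M k j * h j - M k j0 / M i j0 * (M i j * h j))"
          by (intro sum.cong) (auto simp: M'_def algebra_simps)
        also have "\<dots> = (\<Sum>j\<in>J'. M k j * h j) - M k j0 / M i j0 * s"
          by (simp add: sum_subtractf sum_distrib_left s_def)
        finally show ?thesis by (simp add: split on) (simp add: h'_def)
      qed
      then have "h' j = 0" using j by (intro insert.prems(2)[of h']) (auto simp: J'_def)
      then show "h j = 0" using j by (auto simp: h'_def J'_def)
    qed
    have "\<exists>w. \<forall>j\<in>J. (\<Sum>i\<in>insert i I. w i * M i j) = y j" for y
    proof -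
      \<comment> \<open>The right-hand side is corrected in advance for the multiple of row
        \<open>i\<close> that the equation at \<open>j0\<close> will force.\<close>
      obtain w where w: "\<And>j. j \<in> J' \<Longrightarrow> (\<Sum>k\<in>I. w k * M' k j) = y j - y j0 * M i j / M i j0"
        using IH by (elim conjE allE[of _ "\<lambda>j. y j - y j0 * M i j / M i j0"]) auto
      define s where "s = (\<Sum>k\<in>I. w k * M k j0)"
      define w' where "w' = w(i := (y j0 - s) / M i j0)"
      have w': "(\<Sum>k\<in>insert i I. w' k * M k j) = (y j0 - s) / M i j0 * M i j + (\<Sum>k\<in>I. w k * M k j)" for j
      proof -
        have "(\<Sum>k\<in>I. w' k * M k j) = (\<Sum>k\<in>I. w k * M k j)"
          using insert.hyps by (intro sum.cong) (auto simp: w'_def)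
        then show ?thesis using insert.hyps by (simp add: w'_def)
      qed
      have "(\<Sum>k\<in>insert i I. w' k * M k j) = y j" if j: "j \<in> J" for j
      proof (cases "j = j0")
        case True
        then show ?thesis using j0 by (simp only: w') (simp add: s_def)
      next
        case False
        then have "y j - y j0 * M i j / M i j0 = (\<Sum>k\<in>I. w k * M' k j)" using w j by (simp add: J'_def)
        also have "\<dots> = (\<Sum>k\<in>I. w k * M k j - M i j / M i j0 * (w k * M k j0))"
          by (intro sum.cong) (auto simp: M'_def algebra_simps)
        also have "\<dots> = (\<Sum>k\<in>I. w k * M k j) - M i j / M i j0 * s"
          by (simp add: sum_subtractf sum_distrib_left s_def)
        finally show ?thesis using j0 by (simp only: w') (simp add: field_simps)
      qed
      then show ?thesis by blast
    qed
    moreover have "card J \<le> card (insert i I)"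
      using IH j0 insert.prems(1) insert.hyps by (auto simp: J'_def card_Diff_singleton)
    ultimately show ?thesis by blast
  qed
qed

section \<open>Collapsing by levels\<close>

text \<open>Induction over families \<open>Y\<close> closed downwards with respect to
  \<open>g\<close>. The top level of \<open>g\<close> in \<open>Y\<close> is an interval from
  \<open>\<sigma>\<close> to \<open>T\<close>, so \<open>T\<close> is the only facet above
  \<open>\<sigma>\<close>, and collapsing \<open>\<sigma>\<close> deletes exactly this level. What
  remains is again such a family.\<close>

lemma collapse_by_levels:
  fixes g :: "'a set \<Rightarrow> real"
  assumes finX: "finite X" and finF: "\<And>F. F \<in> X \<Longrightarrow> finite F"
    and mono: "\<And>F G. F \<in> X \<Longrightarrow> G \<in> X \<Longrightarrow> F \<subseteq> G \<Longrightarrow> g F \<le> g G"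
    and level: "\<And>F. F \<in> X \<Longrightarrow> F \<noteq> {} \<Longrightarrow> g {} < g F \<and>
      (\<exists>\<sigma>\<in>X. \<exists>T\<in>X. card \<sigma> \<le> d \<and> (\<forall>G\<in>X. g G = g F \<longleftrightarrow> \<sigma> \<subseteq> G \<and> G \<subseteq> T))"
    and Y: "Y \<subseteq> X" "{} \<in> Y" "\<And>F G. F \<in> Y \<Longrightarrow> G \<in> X \<Longrightarrow> g G \<le> g F \<Longrightarrow> G \<in> Y"
  shows "(elementary_collapse d)\<^sup>*\<^sup>* Y {{}}"
  using Y
proof (induction "card Y" arbitrary: Y rule: less_induct)
  case less
  have finY: "finite Y" using finX less.prems finite_subset by blast
  show ?case
  proof (cases "Y = {{}}")
    case False
    then obtain F0 where F0: "F0 \<in> Y" "F0 \<noteq> {}" using less.prems by blast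
    obtain F where F: "F \<in> Y" and max: "\<And>G. G \<in> Y \<Longrightarrow> g G \<le> g F"
    proof -
      have "Max (g ` Y) \<in> g ` Y" using finY F0 by (intro Max_in) auto
      then obtain F where "F \<in> Y" "g F = Max (g ` Y)" by auto
      then show thesis using that finY by auto
    qed
    have FX: "F \<in> X" using F less.prems by auto
    have Fne: "F \<noteq> {}" using max[OF F0(1)] level[of F0] F0 less.prems by force
    obtain \<sigma> T where \<sigma>: "\<sigma> \<in> X" "T \<in> X" "card \<sigma> \<le> d" "g {} < g F"
      and "\<forall>G\<in>X. g G = g F \<longleftrightarrow> \<sigma> \<subseteq> G \<and> G \<subseteq> T"
      using level[OF FX Fne] by (elim conjE bexE)
    then have int: "g G = g F \<longleftrightarrow> \<sigma> \<subseteq> G \<and> G \<subseteq> T" if "G \<in> X" for G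
      using that by (elim bspec)
    have sub: "\<sigma> \<subseteq> T" using int[OF FX] by auto
    have gT: "g \<sigma> = g F" "g T = g F" using int \<sigma> sub by auto
    have TY: "\<sigma> \<in> Y" "T \<in> Y" using less.prems(3)[OF F] \<sigma> gT by auto
    \<comment> \<open>Monotonicity from \<open>\<sigma>\<close> and maximality of \<open>g F\<close>
      squeeze \<open>g G\<close>.\<close>
    have top: "g G = g F" if "G \<in> Y" "\<sigma> \<subseteq> G" for G
      using mono[of \<sigma> G] that \<sigma> less.prems gT max[of G] by force
    have up: "G \<subseteq> T" if "G \<in> Y" "\<sigma> \<subseteq> G" for G
      using top[OF that] int that less.prems by blast
    define Z where "Z = {\<rho>\<in>Y. \<not> \<sigma> \<subseteq> \<rho>}"
    have "\<exists>!\<tau>. facet Y \<tau> \<and> \<sigma> \<subseteq> \<tau>"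
    proof (rule ex1I[of _ T])
      have "\<rho> = T" if "\<rho> \<in> Y" "T \<subseteq> \<rho>" for \<rho>
        using up[OF that(1)] sub that(2) by blast
      then show "facet Y T \<and> \<sigma> \<subseteq> T" using TY(2) sub by (simp add: facet_def)
      fix \<tau> assume \<tau>: "facet Y \<tau> \<and> \<sigma> \<subseteq> \<tau>"
      then have "\<tau> \<subseteq> T" by (intro up) (auto simp: facet_def)
      then show "\<tau> = T" using \<tau> TY(2) by (auto simp: facet_def)
    qed
    then have "elementary_collapse d Y Z"
      unfolding elementary_collapse_def Z_def
      by (intro bexI[OF _ TY(1)] conjI finF[OF \<sigma>(1)] \<sigma>(3) refl)
    moreover have "(elementary_collapse d)\<^sup>*\<^sup>* Z {{}}"
    proof (rule less.hyps)
      show "card Z < card Y"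
        unfolding Z_def using finY TY by (intro psubset_card_mono) auto
      show "Z \<subseteq> X" using less.prems by (auto simp: Z_def)
      show "{} \<in> Z" using less.prems gT \<sigma> by (auto simp: Z_def)
      fix G H assume G: "G \<in> Z" and H: "H \<in> X" "g H \<le> g G"
      have "g G \<noteq> g F" using int[of G] up G less.prems by (auto simp: Z_def)
      then have "g H < g F" using max[of G] G H by (force simp: Z_def)
      then show "H \<in> Z"
        using top[of H] less.prems(3)[of G H] G H by (auto simp: Z_def)
    qed
    ultimately show ?thesis by (rule converse_rtranclp_into_rtranclp)
  qed simp
qed

section \<open>Optimal fractional matchings\<close>

locale finite_hypergraph =
  fixes V :: "'v set" and E :: "'v set set"
  assumes finV: "finite V" and edge: "\<And>e. e \<in> E \<Longrightarrow> e \<subseteq> V \<and> e \<noteq> {}"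
begin

lemma finE: "finite E"
  using edge finV by (meson PowI finite_Pow_iff finite_subset subsetI)

lemma fin_edge: "e \<in> E \<Longrightarrow> finite e"
  using edge finV finite_subset by blast

definition load :: "('v set \<Rightarrow> real) \<Rightarrow> 'v \<Rightarrow> real" where
  "load f v = (\<Sum>e\<in>{e\<in>E. v \<in> e}. f e)"

definition val :: "('v set \<Rightarrow> real) \<Rightarrow> ('v set \<Rightarrow> real) \<Rightarrow> real" where
  "val a f = (\<Sum>e\<in>E. a e * f e)"

text \<open>Values off \<open>F\<close> are fixed to 0, unlike in \<open>feasible\<close>. One
  function can thus be a matching for many \<open>F\<close>, and optimal matchings for different
  \<open>F\<close> can be compared as functions.\<close>

definition matching :: "('v \<Rightarrow> real) \<Rightarrow> 'v set set \<Rightarrow> ('v set \<Rightarrow> real) \<Rightarrow> bool" where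
  "matching b F f \<longleftrightarrow> (\<forall>e. 0 \<le> f e \<and> (e \<notin> F \<longrightarrow> f e = 0)) \<and> (\<forall>v\<in>V. load f v \<le> b v)"

definition supp :: "('v set \<Rightarrow> real) \<Rightarrow> 'v set set" where
  "supp f = {e\<in>E. f e \<noteq> 0}"

definition tight :: "('v \<Rightarrow> real) \<Rightarrow> ('v set \<Rightarrow> real) \<Rightarrow> 'v set" where
  "tight b f = {v\<in>V. load f v = b v}"

lemma load_eq: "load f v = (\<Sum>e\<in>E. of_bool (v \<in> e) * f e)"
  unfolding load_def using finE by (simp add: Int_def)

lemma load_add: "load (\<lambda>e. f e + t * h e) v = load f v + t * load h v"
  unfolding load_def by (simp add: sum.distrib sum_distrib_left)

lemma load_diff: "load (\<lambda>e. f e - h e) v = load f v - load h v"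
  unfolding load_def by (simp add: sum_subtractf)

lemma val_add: "val a (\<lambda>e. f e + t * h e) = val a f + t * val a h"
  unfolding val_def by (simp add: sum.distrib sum_distrib_left algebra_simps)

text \<open>Double counting of incidences. It serves duality, where \<open>w\<close> is a dual
  solution, as well as the counting of tight vertices, where \<open>w\<close> is constantly
  1.\<close>

lemma sum_load: "(\<Sum>v\<in>V. w v * load f v) = (\<Sum>e\<in>E. f e * (\<Sum>v\<in>e. w v))"
proof -
  have "(\<Sum>v\<in>V. w v * load f v) = (\<Sum>v\<in>V. \<Sum>e\<in>E. f e * (of_bool (v \<in> e) * w v))"
    by (simp add: load_eq sum_distrib_left algebra_simps)
  also have "\<dots> = (\<Sum>e\<in>E. f e * (\<Sum>v\<in>V. of_bool (v \<in> e) * w v))"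
    by (subst sum.swap) (simp add: sum_distrib_left)
  also have "\<dots> = (\<Sum>e\<in>E. f e * (\<Sum>v\<in>e. w v))"
  proof (intro sum.cong refl)
    fix e assume e: "e \<in> E"
    have "(\<Sum>v\<in>V. of_bool (v \<in> e) * w v) = (\<Sum>v\<in>e. of_bool (v \<in> e) * w v)"
      using edge[OF e] finV by (intro sum.mono_neutral_right) auto
    then show "f e * (\<Sum>v\<in>V. of_bool (v \<in> e) * w v) = f e * (\<Sum>v\<in>e. w v)" by simp
  qed
  finally show ?thesis .
qed

lemma restrict:
  assumes "F \<subseteq> E" "feasible V b F g"
  defines "h \<equiv> \<lambda>e. if e \<in> F then g e else 0"
  shows "matching b F h" "val a h = (\<Sum>e\<in>F. a e * g e)"
proof -
  have "load h v = (\<Sum>e\<in>{e\<in>F. v \<in> e}. g e)" for v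
  proof -
    have "load h v = (\<Sum>e\<in>{e\<in>F. v \<in> e}. h e)"
      unfolding load_def using assms(1) finE by (intro sum.mono_neutral_right) (auto simp: h_def)
    also have "\<dots> = (\<Sum>e\<in>{e\<in>F. v \<in> e}. g e)" by (intro sum.cong) (auto simp: h_def)
    finally show ?thesis .
  qed
  then show "matching b F h"
    using assms(2) by (auto simp: matching_def feasible_def h_def)
  have "val a h = (\<Sum>e\<in>F. a e * h e)"
    unfolding val_def using assms(1) finE by (intro sum.mono_neutral_right) (auto simp: h_def)
  also have "\<dots> = (\<Sum>e\<in>F. a e * g e)" by (intro sum.cong) (auto simp: h_def)
  finally show "val a h = (\<Sum>e\<in>F. a e * g e)" .
qed

lemma matching_feasible:
  assumes "F \<subseteq> E" "matching b F f"
  shows "feasible V b F f" "(\<Sum>e\<in>F. a e * f e) = val a f"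
proof -
  have "load f v = (\<Sum>e\<in>{e\<in>F. v \<in> e}. f e)" for v
    unfolding load_def using assms finE by (intro sum.mono_neutral_right) (auto simp: matching_def)
  then show "feasible V b F f" using assms(2) by (auto simp: feasible_def matching_def)
  show "(\<Sum>e\<in>F. a e * f e) = val a f"
    unfolding val_def using assms finE by (intro sum.mono_neutral_left) (auto simp: matching_def)
qed

lemma nu_star_optimal:
  assumes F: "F \<subseteq> E" and b: "\<And>v. v \<in> V \<Longrightarrow> 0 \<le> b v"
  obtains f where "matching b F f" "val a f = nu_star V a b F"
    "\<And>g. matching b F g \<Longrightarrow> val a g \<le> nu_star V a b F"
proof -
  have fin: "finite F" using F finE finite_subset by blast
  have ne: "e \<inter> V \<noteq> {}" if "e \<in> F" for e using edge[of e] F that by blast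
  show thesis
  proof (rule nu_star_attained[of F V b a])
    fix g assume g: "feasible V b F g" "(\<Sum>e\<in>F. a e * g e) = nu_star V a b F"
      and max: "\<And>h. feasible V b F h \<Longrightarrow> (\<Sum>e\<in>F. a e * h e) \<le> nu_star V a b F"
    show thesis
    proof (rule that)
      show "matching b F (\<lambda>e. if e \<in> F then g e else 0)" by (rule restrict(1)[OF F g(1)])
      show "val a (\<lambda>e. if e \<in> F then g e else 0) = nu_star V a b F"
        using restrict(2)[OF F g(1), of a] g(2) by simp
      show "val a h \<le> nu_star V a b F" if "matching b F h" for h
        using max[OF matching_feasible(1)[OF F that]] matching_feasible(2)[OF F that, of a] by simp
    qed
  qed (use fin ne b in auto)
qed

definition optimal :: "('v set \<Rightarrow> real) \<Rightarrow> ('v \<Rightarrow> real) \<Rightarrow> 'v set set \<Rightarrow> ('v set \<Rightarrow> real) \<Rightarrow> bool" where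
  "optimal a b F f \<longleftrightarrow> matching b F f \<and> val a f = nu_star V a b F"

lemma nu_star_ge:
  assumes "F \<subseteq> E" "\<And>v. v \<in> V \<Longrightarrow> 0 \<le> b v" "matching b F g"
  shows "val a g \<le> nu_star V a b F"
proof (rule nu_star_optimal[of F b a])
  fix f assume "\<And>g. matching b F g \<Longrightarrow> val a g \<le> nu_star V a b F"
  then show ?thesis using assms(3) .
qed (use assms in auto)

lemma optimal_exists:
  assumes "F \<subseteq> E" "\<And>v. v \<in> V \<Longrightarrow> 0 \<le> b v"
  obtains f where "optimal a b F f"
proof (rule nu_star_optimal[of F b a])
  fix f assume "matching b F f" "val a f = nu_star V a b F"
  then show thesis by (intro that) (simp add: optimal_def)
qed (use assms in auto)

lemma nu_star_mono:
  assumes "F \<subseteq> G" "G \<subseteq> E" "\<And>v. v \<in> V \<Longrightarrow> 0 \<le> b v"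
  shows "nu_star V a b F \<le> nu_star V a b G"
proof -
  obtain f where f: "optimal a b F f" using optimal_exists[of F b a] assms by auto
  then have "matching b G f" using assms(1) by (auto simp: optimal_def matching_def)
  then show ?thesis using nu_star_ge[of G b f a] assms f by (auto simp: optimal_def)
qed

lemma weak_duality:
  assumes F: "F \<subseteq> E" and b: "\<And>v. v \<in> V \<Longrightarrow> 0 \<le> b v"
    and w: "\<And>v. v \<in> V \<Longrightarrow> 0 \<le> w v" "\<And>e. e \<in> F \<Longrightarrow> a e \<le> (\<Sum>v\<in>e. w v)"
  shows "nu_star V a b F \<le> (\<Sum>v\<in>V. w v * b v)"
proof -
  obtain f where f: "optimal a b F f" using optimal_exists[of F b a] F b by auto
  have "val a f \<le> (\<Sum>e\<in>E. f e * (\<Sum>v\<in>e. w v))"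
    unfolding val_def
  proof (intro sum_mono)
    fix e assume "e \<in> E"
    show "a e * f e \<le> f e * (\<Sum>v\<in>e. w v)"
      using f w(2)[of e] by (cases "e \<in> F") (auto simp: optimal_def matching_def mult.commute[of "a e"] intro: mult_left_mono)
  qed
  also have "\<dots> = (\<Sum>v\<in>V. w v * load f v)" by (simp add: sum_load)
  also have "\<dots> \<le> (\<Sum>v\<in>V. w v * b v)"
    using f w(1) by (intro sum_mono mult_left_mono) (auto simp: optimal_def matching_def)
  finally show ?thesis using f by (simp add: optimal_def)
qed

text \<open>First-order optimality: constraints with slack survive a short step along
  \<open>h\<close>, and the active ones are not violated by it. All constraints are finitely many,
  so \<open>f + t h\<close> is a matching on \<open>F\<close> for some \<open>t > 0\<close>, and its
  value cannot exceed the optimum.\<close>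

lemma feasible_direction:
  assumes F: "F \<subseteq> E" and b: "\<And>v. v \<in> V \<Longrightarrow> 0 \<le> b v" and f: "optimal a b F f"
    and h: "\<And>e. e \<notin> F \<Longrightarrow> h e = 0" "\<And>e. e \<in> F \<Longrightarrow> f e = 0 \<Longrightarrow> 0 \<le> h e"
    and tight: "\<And>v. v \<in> tight b f \<Longrightarrow> load h v \<le> 0"
  shows "val a h \<le> 0"
proof -
  have m: "matching b F f" using f by (simp add: optimal_def)
  have "eventually (\<lambda>t. 0 \<le> f e + t * h e) (at_right 0)" if e: "e \<in> F" for e
  proof (cases "f e = 0")
    case True
    then show ?thesis using h(2)[OF e]
      by (auto intro!: eventually_at_right_less[THEN eventually_mono])
  next
    case False
    then have "0 < f e" using m by (auto simp: matching_def less_le)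
    have "((\<lambda>t. f e + t * h e) \<longlongrightarrow> f e + 0 * h e) (at_right 0)" by (intro tendsto_intros)
    then have "eventually (\<lambda>t. 0 < f e + t * h e) (at_right 0)"
      using \<open>0 < f e\<close> by (intro order_tendstoD(1)) auto
    then show ?thesis by (rule eventually_mono) simp
  qed
  moreover have "eventually (\<lambda>t. load f v + t * load h v \<le> b v) (at_right 0)" if v: "v \<in> V" for v
  proof (cases "load f v = b v")
    case True
    then have "load h v \<le> 0" using tight v by (auto simp: tight_def)
    then show ?thesis using True
      by (auto intro!: eventually_at_right_less[THEN eventually_mono] simp: mult_nonneg_nonpos)
  next
    case False
    then have "load f v < b v" using m v by (auto simp: matching_def less_le)
    have "((\<lambda>t. load f v + t * load h v) \<longlongrightarrow> load f v + 0 * load h v) (at_right 0)"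
      by (intro tendsto_intros)
    then have "eventually (\<lambda>t. load f v + t * load h v < b v) (at_right 0)"
      using \<open>load f v < b v\<close> by (intro order_tendstoD(2)) auto
    then show ?thesis by (rule eventually_mono) simp
  qed
  ultimately have "eventually (\<lambda>t. (\<forall>e\<in>F. 0 \<le> f e + t * h e) \<and>
      (\<forall>v\<in>V. load f v + t * load h v \<le> b v) \<and> 0 < t) (at_right (0::real))"
    using finV finE F finite_subset
    by (intro eventually_conj eventually_ball_finite) (auto simp: eventually_at_right_less)
  then obtain t where t: "\<And>e. e \<in> F \<Longrightarrow> 0 \<le> f e + t * h e"
    "\<And>v. v \<in> V \<Longrightarrow> load f v + t * load h v \<le> b v" "0 < t"
    using eventually_happens'[OF trivial_limit_at_right_real] by blast
  have "matching b F (\<lambda>e. f e + t * h e)"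
    unfolding matching_def load_add
  proof (intro conjI allI impI ballI)
    show "0 \<le> f e + t * h e" for e
      using t(1) h(1) m by (cases "e \<in> F") (auto simp: matching_def)
  qed (use t m h(1) in \<open>auto simp: matching_def\<close>)
  then have "val a (\<lambda>e. f e + t * h e) \<le> nu_star V a b F" using b by (intro nu_star_ge[OF F])
  then have "val a f + t * val a h \<le> nu_star V a b F" by (simp add: val_add)
  then show ?thesis using f t(3) by (auto simp: optimal_def mult_le_0_iff)
qed

section \<open>Generic weights\<close>

text \<open>Linear independence of the columns \<open>\<sigma>\<close> of the vertex-edge incidence
  matrix cut down to the rows \<open>S\<close>, phrased with coefficient vectors extended by
  zero.\<close>

definition indep_edges :: "'v set set \<Rightarrow> 'v set \<Rightarrow> bool" where
  "indep_edges \<sigma> S \<longleftrightarrow> (\<forall>h. (\<forall>e. e \<notin> \<sigma> \<longrightarrow> h e = 0) \<longrightarrow> (\<forall>v\<in>S. load h v = 0) \<longrightarrow> (\<forall>e. h e = 0))"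

text \<open>The dual notion: linear independence of the rows \<open>S\<close> cut down to the
  columns \<open>\<sigma>\<close>. Together with \<open>indep_edges\<close> it says that this
  submatrix is square and nonsingular.\<close>

definition indep_vertices :: "'v set set \<Rightarrow> 'v set \<Rightarrow> bool" where
  "indep_vertices \<sigma> S \<longleftrightarrow>
     (\<forall>c. (\<forall>v. v \<notin> S \<longrightarrow> c v = 0) \<longrightarrow> (\<forall>e\<in>\<sigma>. (\<Sum>v\<in>e. c v) = (0::real)) \<longrightarrow> (\<forall>v. c v = 0))"

lemma indep_edgesD:
  "indep_edges \<sigma> S \<Longrightarrow> (\<And>e. e \<notin> \<sigma> \<Longrightarrow> h e = 0) \<Longrightarrow> (\<And>v. v \<in> S \<Longrightarrow> load h v = 0) \<Longrightarrow> h e = 0"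
  unfolding indep_edges_def by (elim allE[of _ h]) simp

lemma indep_verticesD:
  "indep_vertices \<sigma> S \<Longrightarrow> (\<And>v. v \<notin> S \<Longrightarrow> c v = 0) \<Longrightarrow> (\<And>e. e \<in> \<sigma> \<Longrightarrow> (\<Sum>v\<in>e. c v) = 0) \<Longrightarrow> c v = (0::real)"
  unfolding indep_vertices_def by (elim allE[of _ c]) simp

text \<open>The basic feasible solutions of linear programming, that is, the vertices of the
  fractional matching polytope.\<close>

definition basic_matchings :: "('v \<Rightarrow> real) \<Rightarrow> ('v set \<Rightarrow> real) set" where
  "basic_matchings b = {f. matching b E f \<and> indep_edges (supp f) (tight b f)}"

text \<open>A basic matching is determined by its support and its tight vertices: the difference of
  two with the same data is a kernel vector of an injective submatrix.\<close>

lemma finite_basic_matchings: "finite (basic_matchings b)"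
proof (rule inj_on_finite)
  show "inj_on (\<lambda>f. (supp f, tight b f)) (basic_matchings b)"
  proof (rule inj_onI, clarify)
    fix f g assume f: "f \<in> basic_matchings b" and g: "g \<in> basic_matchings b"
      and eq: "supp f = supp g" "tight b f = tight b g"
    have "f e - g e = 0" if "e \<notin> supp f" for e
      using f g eq that by (auto simp: basic_matchings_def matching_def supp_def)
    moreover have "load (\<lambda>e. f e - g e) v = 0" if "v \<in> tight b f" for v
      using that eq by (auto simp: load_diff tight_def set_eq_iff)
    ultimately have "f e - g e = 0" for e
      using indep_edgesD[of "supp f" "tight b f" "\<lambda>e. f e - g e" e] f
      by (simp add: basic_matchings_def)
    then show "f = g" by auto
  qed
  show "(\<lambda>f. (supp f, tight b f)) ` basic_matchings b \<subseteq> Pow E \<times> Pow V"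
    by (auto simp: supp_def tight_def)
  show "finite (Pow E \<times> Pow V)" using finE finV by simp
qed

text \<open>A linear relation \<open>c\<close> among the rows of \<open>S = tight b f\<close> on the
  support of \<open>f\<close> gives \<open>\<Sum> c v * b v = 0\<close>, because \<open>b\<close>
  agrees with the load on \<open>S\<close>. So \<open>b\<close> would lie on a hyperplane that
  depends only on the pair of support and tight set, and there are finitely many pairs.\<close>

lemma generic_vertex_weights:
  fixes l u :: "'v \<Rightarrow> real"
  assumes "\<And>v. v \<in> V \<Longrightarrow> l v < u v"
  obtains b where "\<And>v. v \<in> V \<Longrightarrow> l v \<le> b v \<and> b v < u v"
    "\<And>f. indep_vertices (supp f) (tight b f)"
proof -
  define bad where "bad = {(\<sigma>, S). \<sigma> \<in> Pow E \<and> S \<in> Pow V \<and> \<not> indep_vertices \<sigma> S}"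
  define kernel where "kernel \<sigma> S c \<longleftrightarrow>
    (\<forall>v. v \<notin> S \<longrightarrow> c v = 0) \<and> (\<forall>e\<in>\<sigma>. (\<Sum>v\<in>e. c v) = (0::real)) \<and> (\<exists>v. c v \<noteq> 0)" for \<sigma> :: "'v set set" and S c
  define c where "c \<sigma> S = (SOME c. kernel \<sigma> S c)" for \<sigma> S
  have "kernel \<sigma> S (c \<sigma> S)" if "(\<sigma>, S) \<in> bad" for \<sigma> S
  proof -
    have "\<exists>c. kernel \<sigma> S c" using that by (auto simp: bad_def indep_vertices_def kernel_def)
    then show ?thesis unfolding c_def by (rule someI_ex)
  qed
  then have c: "\<And>\<sigma> S v. (\<sigma>, S) \<in> bad \<Longrightarrow> v \<notin> S \<Longrightarrow> c \<sigma> S v = 0"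
    "\<And>\<sigma> S e. (\<sigma>, S) \<in> bad \<Longrightarrow> e \<in> \<sigma> \<Longrightarrow> (\<Sum>v\<in>e. c \<sigma> S v) = 0"
    "\<And>\<sigma> S. (\<sigma>, S) \<in> bad \<Longrightarrow> \<exists>v. c \<sigma> S v \<noteq> 0"
    unfolding kernel_def by blast+
  have "finite bad"
    using finE finV by (intro finite_subset[of bad "Pow E \<times> Pow V"]) (auto simp: bad_def)
  then have fin: "finite (case_prod c ` bad)" by simp
  have ne: "\<exists>v\<in>V. x v \<noteq> 0" if x: "x \<in> case_prod c ` bad" for x
  proof -
    obtain \<sigma> S where \<sigma>: "(\<sigma>, S) \<in> bad" "x = c \<sigma> S" using x by auto
    then obtain v where "x v \<noteq> 0" using c(3) by blast
    then show ?thesis using c(1)[OF \<sigma>(1), of v] \<sigma> by (auto simp: bad_def)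
  qed
  obtain b where b: "\<And>v. v \<in> V \<Longrightarrow> l v \<le> b v \<and> b v < u v"
    and nz: "\<And>x. x \<in> case_prod c ` bad \<Longrightarrow> (\<Sum>v\<in>V. x v * b v) \<noteq> 0"
    using avoid_hyperplanes[of _ _ l u, OF fin finV assms ne] by blast
  have "indep_vertices (supp f) (tight b f)" for f
  proof (rule ccontr)
    assume "\<not> indep_vertices (supp f) (tight b f)"
    then have bd: "(supp f, tight b f) \<in> bad"
      by (auto simp: bad_def supp_def tight_def)
    define x where "x = c (supp f) (tight b f)"
    have "(\<Sum>v\<in>V. x v * b v) = (\<Sum>v\<in>V. x v * load f v)"
      using c(1)[OF bd] by (intro sum.cong) (auto simp: x_def tight_def)
    also have "\<dots> = (\<Sum>e\<in>E. f e * (\<Sum>v\<in>e. x v))" by (rule sum_load)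
    also have "\<dots> = 0" using c(2)[OF bd] by (intro sum.neutral) (auto simp: x_def supp_def)
    finally show False using nz[of x] bd by (force simp: x_def)
  qed
  with b show thesis by (rule that)
qed

text \<open>With \<open>b\<close> fixed, the basic matchings form a finite set, and \<open>a\<close>
  has to avoid two finite families of hyperplanes: one makes every optimal matching basic, the other
  separates the values of basic matchings.\<close>

lemma generic_edge_weights:
  fixes l u :: "'v set \<Rightarrow> real"
  assumes lu: "\<And>e. e \<in> E \<Longrightarrow> l e < u e" and b: "\<And>v. v \<in> V \<Longrightarrow> 0 \<le> b v"
  obtains a where "\<And>e. e \<in> E \<Longrightarrow> l e \<le> a e \<and> a e < u e"
    "\<And>F f. F \<subseteq> E \<Longrightarrow> optimal a b F f \<Longrightarrow> f \<in> basic_matchings b"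
    "\<And>f g. f \<in> basic_matchings b \<Longrightarrow> g \<in> basic_matchings b \<Longrightarrow> val a f = val a g \<Longrightarrow> f = g"
proof -
  define bad where "bad = {(\<sigma>, S). \<sigma> \<in> Pow E \<and> S \<in> Pow V \<and> \<not> indep_edges \<sigma> S}"
  define kernel where "kernel \<sigma> S h \<longleftrightarrow>
    (\<forall>e. e \<notin> \<sigma> \<longrightarrow> h e = 0) \<and> (\<forall>v\<in>S. load h v = 0) \<and> (\<exists>e. h e \<noteq> 0)" for \<sigma> S h
  define c where "c \<sigma> S = (SOME h. kernel \<sigma> S h)" for \<sigma> S
  have "kernel \<sigma> S (c \<sigma> S)" if "(\<sigma>, S) \<in> bad" for \<sigma> S
  proof -
    have "\<exists>h. kernel \<sigma> S h" using that by (auto simp: bad_def indep_edges_def kernel_def)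
    then show ?thesis unfolding c_def by (rule someI_ex)
  qed
  then have c: "\<And>\<sigma> S e. (\<sigma>, S) \<in> bad \<Longrightarrow> e \<notin> \<sigma> \<Longrightarrow> c \<sigma> S e = 0"
    "\<And>\<sigma> S v. (\<sigma>, S) \<in> bad \<Longrightarrow> v \<in> S \<Longrightarrow> load (c \<sigma> S) v = 0"
    "\<And>\<sigma> S. (\<sigma>, S) \<in> bad \<Longrightarrow> \<exists>e. c \<sigma> S e \<noteq> 0"
    unfolding kernel_def by blast+
  \<comment> \<open>A form in \<open>D\<close> vanishes at \<open>a\<close> exactly when two
    different basic matchings tie.\<close>
  define D where "D = (\<lambda>(f, g) e. f e - g e) `
    {(f, g) \<in> basic_matchings b \<times> basic_matchings b. f \<noteq> g}"
  have "finite bad"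
    using finE finV by (intro finite_subset[of bad "Pow E \<times> Pow V"]) (auto simp: bad_def)
  moreover have "finite D"
    unfolding D_def
    by (rule finite_imageI, rule finite_subset[of _ "basic_matchings b \<times> basic_matchings b"])
      (auto simp: finite_basic_matchings)
  ultimately have fin: "finite (case_prod c ` bad \<union> D)" by simp
  have ne: "\<exists>e\<in>E. x e \<noteq> 0" if "x \<in> case_prod c ` bad \<union> D" for x
    using that
  proof
    assume "x \<in> case_prod c ` bad"
    then obtain \<sigma> S where \<sigma>: "(\<sigma>, S) \<in> bad" "x = c \<sigma> S" by auto
    then obtain e where "x e \<noteq> 0" using c(3) by blast
    then show ?thesis using c(1)[OF \<sigma>(1), of e] \<sigma> by (auto simp: bad_def)
  next
    assume "x \<in> D"
    then obtain f g where fg: "f \<in> basic_matchings b" "g \<in> basic_matchings b" "f \<noteq> g"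
      "x = (\<lambda>e. f e - g e)"
      by (auto simp: D_def)
    then obtain e where "f e \<noteq> g e" by auto
    then show ?thesis
      using fg by (intro bexI[of _ e]) (auto simp: basic_matchings_def matching_def)
  qed
  obtain a where a: "\<And>e. e \<in> E \<Longrightarrow> l e \<le> a e \<and> a e < u e"
    and nz: "\<And>x. x \<in> case_prod c ` bad \<union> D \<Longrightarrow> (\<Sum>e\<in>E. x e * a e) \<noteq> 0"
    using avoid_hyperplanes[of _ _ l u, OF fin finE lu ne] by blast
  have nz: "val a x \<noteq> 0" if "x \<in> case_prod c ` bad \<union> D" for x
    using nz[OF that] by (simp add: val_def mult.commute)
  have "f \<in> basic_matchings b" if F: "F \<subseteq> E" and f: "optimal a b F f" for F f
  proof -
    have "indep_edges (supp f) (tight b f)"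
    proof (rule ccontr)
      assume "\<not> indep_edges (supp f) (tight b f)"
      then have bd: "(supp f, tight b f) \<in> bad"
        by (auto simp: bad_def supp_def tight_def)
      define x where "x = c (supp f) (tight b f)"
      have out: "x e = 0" if "f e = 0" for e
        using c(1)[OF bd, of e] that by (auto simp: x_def supp_def)
      have out': "x e = 0" if "e \<notin> F" for e
        using out f that by (auto simp: optimal_def matching_def)
      have tx: "load x v = 0" if "v \<in> tight b f" for v
        using c(2)[OF bd that] by (simp add: x_def)
      \<comment> \<open>The kernel vector \<open>x\<close> lives on the support of \<open>f\<close>
        and does not change tight loads, so both \<open>x\<close> and \<open>- x\<close> are
        feasible directions and \<open>val a x\<close> must be 0.\<close>
      have "val a x \<le> 0"
        using out out' tx by (intro feasible_direction[OF F b f]) auto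
      moreover have neg: "load (\<lambda>e. - x e) v = - load x v" "val a (\<lambda>e. - x e) = - val a x" for v
        by (simp_all add: load_def val_def sum_negf)
      have "val a (\<lambda>e. - x e) \<le> 0"
        using out out' tx by (intro feasible_direction[OF F b f]) (auto simp: neg)
      ultimately have "val a x = 0" by (simp add: neg)
      then show False using nz[of x] bd by (force simp: x_def)
    qed
    then show ?thesis using f F by (auto simp: basic_matchings_def optimal_def matching_def)
  qed
  moreover have "f = g" if "f \<in> basic_matchings b" "g \<in> basic_matchings b" "val a f = val a g" for f g
  proof (rule ccontr)
    assume "f \<noteq> g"
    then have "(\<lambda>e. f e - g e) \<in> D" using that by (force simp: D_def)
    moreover have "val a (\<lambda>e. f e - g e) = 0"
      using that(3) by (simp add: val_def sum_subtractf algebra_simps)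
    ultimately show False using nz by blast
  qed
  ultimately show thesis using a by (intro that[of a]) auto
qed

section \<open>Solving linear systems with submatrices of the incidence matrix\<close>

lemma sum_vertices_eq:
  assumes "S \<subseteq> V" "e \<in> E" "\<And>v. v \<notin> S \<Longrightarrow> w v = 0"
  shows "(\<Sum>v\<in>S. w v * of_bool (v \<in> e)) = (\<Sum>v\<in>e. w v :: real)"
proof -
  have "(\<Sum>v\<in>S. w v * of_bool (v \<in> e)) = (\<Sum>v\<in>S \<inter> e. w v * of_bool (v \<in> e))"
    using finite_subset[OF assms(1) finV] by (intro sum.mono_neutral_right) auto
  also have "\<dots> = (\<Sum>v\<in>S \<inter> e. w v)" by (intro sum.cong) auto
  also have "\<dots> = (\<Sum>v\<in>e. w v)"
    using assms(3) fin_edge[OF assms(2)] by (intro sum.mono_neutral_left) auto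
  finally show ?thesis .
qed

lemma sum_edges_eq:
  assumes "\<sigma> \<subseteq> E" "\<And>e. e \<notin> \<sigma> \<Longrightarrow> h e = 0"
  shows "(\<Sum>e\<in>\<sigma>. of_bool (v \<in> e) * h e) = load h v"
  unfolding load_eq using assms finE by (intro sum.mono_neutral_left) auto

text \<open>Independent columns make the transposed system solvable: vertex weights on
  \<open>S\<close> can be prescribed by their sums over the edges of \<open>\<sigma>\<close>. With
  \<open>y = a\<close> this produces the dual solution.\<close>

lemma indep_edges_solve:
  fixes y :: "'v set \<Rightarrow> real"
  assumes \<sigma>: "\<sigma> \<subseteq> E" and S: "S \<subseteq> V" and ind: "indep_edges \<sigma> S"
  shows "card \<sigma> \<le> card S"
    "\<exists>w. (\<forall>v. v \<notin> S \<longrightarrow> w v = 0) \<and> (\<forall>e\<in>\<sigma>. (\<Sum>v\<in>e. w v) = y e)"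
proof -
  have fin: "finite \<sigma>" "finite S" using \<sigma> S finE finV finite_subset by blast+
  have *: "card \<sigma> \<le> card S \<and> (\<forall>y. \<exists>w. \<forall>e\<in>\<sigma>. (\<Sum>v\<in>S. w v * of_bool (v \<in> e)) = (y e :: real))"
  proof (rule trivial_kernel_imp_transpose_onto[OF fin(2,1)])
    fix h :: "'v set \<Rightarrow> real" and e
    assume h: "\<And>v. v \<in> S \<Longrightarrow> (\<Sum>e\<in>\<sigma>. of_bool (v \<in> e) * h e) = 0" and e: "e \<in> \<sigma>"
    define k where "k e = (if e \<in> \<sigma> then h e else 0)" for e
    have "load k v = 0" if "v \<in> S" for v
    proof -
      have "load k v = (\<Sum>e\<in>\<sigma>. of_bool (v \<in> e) * k e)"
        using \<sigma> by (intro sum_edges_eq[symmetric]) (auto simp: k_def)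
      also have "\<dots> = (\<Sum>e\<in>\<sigma>. of_bool (v \<in> e) * h e)" by (intro sum.cong) (auto simp: k_def)
      finally show ?thesis using h[OF that] by simp
    qed
    then have "k e = 0" by (rule indep_edgesD[OF ind, rotated]) (auto simp: k_def)
    then show "h e = 0" using e by (simp add: k_def)
  qed
  show "card \<sigma> \<le> card S" using * by simp
  obtain w where w: "\<And>e. e \<in> \<sigma> \<Longrightarrow> (\<Sum>v\<in>S. w v * of_bool (v \<in> e)) = y e" using * by blast
  define x where "x v = (if v \<in> S then w v else 0)" for v
  have "(\<Sum>v\<in>e. x v) = y e" if e: "e \<in> \<sigma>" for e
  proof -
    have "(\<Sum>v\<in>e. x v) = (\<Sum>v\<in>S. x v * of_bool (v \<in> e))"
      using S \<sigma> e by (intro sum_vertices_eq[symmetric]) (auto simp: x_def)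
    also have "\<dots> = (\<Sum>v\<in>S. w v * of_bool (v \<in> e))" by (intro sum.cong) (auto simp: x_def)
    finally show ?thesis using w[OF e] by simp
  qed
  then show "\<exists>w. (\<forall>v. v \<notin> S \<longrightarrow> w v = 0) \<and> (\<forall>e\<in>\<sigma>. (\<Sum>v\<in>e. w v) = y e)"
    by (intro exI[of _ x]) (auto simp: x_def)
qed

text \<open>The same argument with rows and columns exchanged. It supplies directions supported on
  \<open>\<sigma>\<close> with arbitrary prescribed loads on \<open>S\<close>.\<close>

lemma indep_vertices_solve:
  fixes y :: "'v \<Rightarrow> real"
  assumes \<sigma>: "\<sigma> \<subseteq> E" and S: "S \<subseteq> V" and ind: "indep_vertices \<sigma> S"
  shows "\<exists>h. (\<forall>e. e \<notin> \<sigma> \<longrightarrow> h e = 0) \<and> (\<forall>v\<in>S. load h v = y v)"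
proof -
  have fin: "finite \<sigma>" "finite S" using \<sigma> S finE finV finite_subset by blast+
  have "card S \<le> card \<sigma> \<and> (\<forall>y. \<exists>h. \<forall>v\<in>S. (\<Sum>e\<in>\<sigma>. h e * of_bool (v \<in> e)) = (y v :: real))"
  proof (rule trivial_kernel_imp_transpose_onto[OF fin])
    fix c :: "'v \<Rightarrow> real" and v
    assume c: "\<And>e. e \<in> \<sigma> \<Longrightarrow> (\<Sum>v\<in>S. of_bool (v \<in> e) * c v) = 0" and v: "v \<in> S"
    define k where "k v = (if v \<in> S then c v else 0)" for v
    have "(\<Sum>v\<in>e. k v) = 0" if e: "e \<in> \<sigma>" for e
    proof -
      have "(\<Sum>v\<in>e. k v) = (\<Sum>v\<in>S. k v * of_bool (v \<in> e))"
        using S \<sigma> e by (intro sum_vertices_eq[symmetric]) (auto simp: k_def)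
      also have "\<dots> = (\<Sum>v\<in>S. of_bool (v \<in> e) * c v)" by (intro sum.cong) (auto simp: k_def)
      finally show ?thesis using c[OF e] by simp
    qed
    then have "k v = 0" by (rule indep_verticesD[OF ind, rotated]) (auto simp: k_def)
    then show "c v = 0" using v by (simp add: k_def)
  qed
  then obtain h where h: "\<And>v. v \<in> S \<Longrightarrow> (\<Sum>e\<in>\<sigma>. h e * of_bool (v \<in> e)) = y v" by blast
  define k where "k e = (if e \<in> \<sigma> then h e else 0)" for e
  have "load k v = y v" if v: "v \<in> S" for v
  proof -
    have "load k v = (\<Sum>e\<in>\<sigma>. of_bool (v \<in> e) * k e)"
      using \<sigma> by (intro sum_edges_eq[symmetric]) (auto simp: k_def)
    also have "\<dots> = (\<Sum>e\<in>\<sigma>. h e * of_bool (v \<in> e))" by (intro sum.cong) (auto simp: k_def)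
    finally show ?thesis using h[OF v] by simp
  qed
  then show ?thesis by (intro exI[of _ k]) (auto simp: k_def)
qed

section \<open>Levels of the fractional matching number\<close>

text \<open>
  The point is that \<open>w\<close> is determined by \<open>f\<close> alone, so that it is dual feasible for every
  \<open>F\<close> on which \<open>f\<close> is optimal.
\<close>
lemma dual_certificate:
  assumes b: "\<And>v. v \<in> V \<Longrightarrow> 0 \<le> b v"
    and edges: "indep_edges (supp f) (tight b f)" and vertices: "indep_vertices (supp f) (tight b f)"
  obtains w where
    "\<And>e. e \<in> supp f \<Longrightarrow> (\<Sum>v\<in>e. w v) = a e"
    "(\<Sum>v\<in>V. w v * b v) = val a f"
    "\<And>F v. F \<subseteq> E \<Longrightarrow> optimal a b F f \<Longrightarrow> 0 \<le> w v"
    "\<And>F e. F \<subseteq> E \<Longrightarrow> optimal a b F f \<Longrightarrow> e \<in> F \<Longrightarrow> a e \<le> (\<Sum>v\<in>e. w v)"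
proof -
  define \<sigma> where "\<sigma> = supp f"
  define S where "S = tight b f"
  have \<sigma>: "\<sigma> \<subseteq> E" and S: "S \<subseteq> V" by (auto simp: \<sigma>_def S_def supp_def tight_def)
  \<comment> \<open>Complementary slackness is built in: \<open>w\<close> vanishes off the tight
    vertices and covers each edge of the support exactly.\<close>
  obtain w where w0: "\<And>v. v \<notin> S \<Longrightarrow> w v = 0" and w: "\<And>e. e \<in> \<sigma> \<Longrightarrow> (\<Sum>v\<in>e. w v) = a e"
    using indep_edges_solve(2)[OF \<sigma> S, of a] edges by (auto simp: \<sigma>_def S_def)
  have solve: "\<exists>h. (\<forall>e. e \<notin> \<sigma> \<longrightarrow> h e = 0) \<and> (\<forall>v\<in>S. load h v = y v)" for y
    using indep_vertices_solve[OF \<sigma> S] vertices by (simp add: \<sigma>_def S_def)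
  have val: "val a h = (\<Sum>v\<in>S. w v * load h v)" if h: "\<And>e. e \<notin> \<sigma> \<Longrightarrow> h e = 0" for h
  proof -
    have "val a h = (\<Sum>e\<in>E. h e * (\<Sum>v\<in>e. w v))"
      unfolding val_def using h w by (intro sum.cong) (metis mult.commute mult_zero_left mult_zero_right)+
    also have "\<dots> = (\<Sum>v\<in>V. w v * load h v)" by (simp add: sum_load)
    also have "\<dots> = (\<Sum>v\<in>S. w v * load h v)"
      using S finV w0 by (intro sum.mono_neutral_right) auto
    finally show ?thesis .
  qed
  have sub: "e \<in> F" "f e \<noteq> 0" if "F \<subseteq> E" "optimal a b F f" "e \<in> \<sigma>" for F e
    using that by (auto simp: \<sigma>_def supp_def optimal_def matching_def)
  show thesis
  proof
    show "(\<Sum>v\<in>e. w v) = a e" if "e \<in> supp f" for e using w that by (simp add: \<sigma>_def)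
  next
    have "(\<Sum>v\<in>V. w v * b v) = (\<Sum>v\<in>V. w v * load f v)"
      using w0 by (intro sum.cong) (auto simp: S_def tight_def)
    also have "\<dots> = (\<Sum>e\<in>E. f e * (\<Sum>v\<in>e. w v))" by (rule sum_load)
    also have "\<dots> = val a f"
      unfolding val_def using w by (intro sum.cong) (auto simp: \<sigma>_def supp_def)
    finally show "(\<Sum>v\<in>V. w v * b v) = val a f" .
  next
    fix F v assume F: "F \<subseteq> E" and f: "optimal a b F f"
    show "0 \<le> w v"
    proof (cases "v \<in> S")
      case True
      \<comment> \<open>This direction lowers the load at \<open>v\<close> by one and keeps every
        other tight load. Its value is \<open>- w v\<close>, which optimality makes nonpositive.
        Signs on \<open>\<sigma>\<close> are free because \<open>f\<close> is positive
        there.\<close>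
      obtain h where h0: "\<And>e. e \<notin> \<sigma> \<Longrightarrow> h e = 0"
        and h: "\<And>u. u \<in> S \<Longrightarrow> load h u = - of_bool (u = v)"
        using solve[of "\<lambda>u. - of_bool (u = v)"] by auto
      have "h e = 0" if "e \<notin> F \<or> f e = 0" for e
        using h0 sub[OF F f] that by blast
      then have "val a h \<le> 0"
        using h by (intro feasible_direction[OF F b f]) (auto simp: S_def)
      moreover have "val a h = (\<Sum>u\<in>S. if u = v then - w v else 0)"
        using val[of h] h0 by (auto simp: h intro!: sum.cong)
      moreover have "finite S" using S finV finite_subset by blast
      ultimately show ?thesis using True by simp
    qed (use w0 in simp)
  next
    fix F e0 assume F: "F \<subseteq> E" and f: "optimal a b F f" and e0: "e0 \<in> F"
    show "a e0 \<le> (\<Sum>v\<in>e0. w v)"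
    proof (cases "e0 \<in> \<sigma>")
      case False
      have e0E: "e0 \<in> E" using e0 F by auto
      obtain h where h0: "\<And>e. e \<notin> \<sigma> \<Longrightarrow> h e = 0"
        and h: "\<And>u. u \<in> S \<Longrightarrow> load h u = - of_bool (u \<in> e0)"
        using solve[of "\<lambda>u. - of_bool (u \<in> e0)"] by auto
      \<comment> \<open>One unit is added on \<open>e0\<close> and compensated by \<open>h\<close>
        on the support, so that no tight load changes. The value of \<open>k\<close> is
        \<open>a e0\<close> minus the \<open>w\<close>-weight of \<open>e0\<close>. The factor 1
        fits the shape of \<open>load_add\<close> and \<open>val_add\<close>.\<close>
      define k where "k e = h e + 1 * of_bool (e = e0)" for e
      have "load (\<lambda>e. of_bool (e = e0)) u = of_bool (u \<in> e0)" for u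
        using e0E finE by (simp add: load_def of_bool_def)
      then have lk: "load k u = 0" if "u \<in> S" for u
        unfolding k_def load_add using h[OF that] by simp
      have "h e = 0" if "e \<notin> F \<or> f e = 0" for e
        using h0 sub[OF F f] that by blast
      then have "val a k \<le> 0"
        using lk e0 by (intro feasible_direction[OF F b f]) (auto simp: S_def k_def)
      moreover have "val a k = val a h + a e0"
        unfolding k_def val_add using e0E finE by (simp add: val_def of_bool_def if_distrib cong: if_cong)
      moreover have "val a h = - (\<Sum>v\<in>S. w v * of_bool (v \<in> e0))"
        using val[of h] h0 by (simp add: h sum_negf)
      moreover have "(\<Sum>v\<in>S. w v * of_bool (v \<in> e0)) = (\<Sum>v\<in>e0. w v)"
        using S e0E w0 by (rule sum_vertices_eq)
      ultimately show ?thesis by simp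
    qed (use w in simp)
  qed
qed

lemma nu_star_pos:
  assumes F: "F \<subseteq> E" "F \<noteq> {}" and a: "\<And>e. e \<in> E \<Longrightarrow> 0 < a e" and b: "\<And>v. v \<in> V \<Longrightarrow> 0 < b v"
  shows "0 < nu_star V a b F"
proof -
  obtain e0 where e0: "e0 \<in> F" "e0 \<in> E" using F by auto
  have ne: "V \<noteq> {}" using edge[OF e0(2)] by auto
  \<comment> \<open>Weight \<open>t\<close> on a single edge respects every vertex bound, which
    already gives a positive value.\<close>
  define t where "t = Min (b ` V)"
  have t: "0 < t" "\<And>v. v \<in> V \<Longrightarrow> t \<le> b v" using finV ne b by (auto simp: t_def)
  define g where "g e = (if e = e0 then t else 0)" for e
  have "load g v = (if v \<in> e0 then t else 0)" for v
    using e0 finE by (simp add: load_def g_def)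
  then have "matching b F g"
    using t e0 b by (auto simp: matching_def g_def less_imp_le)
  then have "val a g \<le> nu_star V a b F"
    using b by (intro nu_star_ge[OF F(1)]) (auto simp: less_imp_le)
  moreover have "val a g = a e0 * t"
    using e0 finE by (simp add: val_def g_def if_distrib cong: if_cong)
  moreover have "0 < a e0 * t" using a e0 t by simp
  ultimately show ?thesis by simp
qed

lemma nu_star_empty:
  assumes "\<And>v. v \<in> V \<Longrightarrow> 0 \<le> b v"
  shows "nu_star V a b {} = 0"
proof -
  obtain f where f: "optimal a b {} f" using optimal_exists[of "{}" b a] assms by auto
  then show ?thesis by (auto simp: optimal_def matching_def val_def)
qed

text \<open>Each tight vertex carries load at least \<open>\<beta>\<close>, the total load is at
  most \<open>r\<close> times the total weight of \<open>f\<close>, and \<open>\<alpha>\<close>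
  times that weight is at most \<open>val a f\<close>.\<close>

lemma card_tight_le:
  assumes r: "\<And>e. e \<in> E \<Longrightarrow> card e \<le> r" and m: "matching b E f"
    and \<alpha>: "0 < \<alpha>" "\<And>e. e \<in> E \<Longrightarrow> \<alpha> \<le> a e" and \<beta>: "0 < \<beta>" "\<And>v. v \<in> V \<Longrightarrow> \<beta> \<le> b v"
  shows "real (card (tight b f)) \<le> real r * val a f / (\<alpha> * \<beta>)"
proof -
  have f0: "0 \<le> f e" for e using m by (auto simp: matching_def)
  have "real (card (tight b f)) * \<beta> \<le> (\<Sum>v\<in>tight b f. load f v)"
    using \<beta>(2) by (intro sum_bounded_below) (auto simp: tight_def)
  also have "\<dots> \<le> (\<Sum>v\<in>V. load f v)"
    using finV f0 by (intro sum_mono2) (auto simp: tight_def load_def intro: sum_nonneg)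
  also have "\<dots> = (\<Sum>e\<in>E. f e * real (card e))"
    using sum_load[of "\<lambda>_. 1" f] by simp
  also have "\<dots> \<le> (\<Sum>e\<in>E. f e * real r)"
    using f0 r by (intro sum_mono mult_left_mono) auto
  finally have "\<alpha> * (real (card (tight b f)) * \<beta>) \<le> \<alpha> * (\<Sum>e\<in>E. f e * real r)"
    using \<alpha> by (intro mult_left_mono) auto
  also have "\<dots> = (\<Sum>e\<in>E. \<alpha> * f e) * real r"
    by (simp add: sum_distrib_left sum_distrib_right algebra_simps)
  also have "\<dots> \<le> val a f * real r"
    unfolding val_def using \<alpha> f0 by (intro mult_right_mono sum_mono) auto
  finally show ?thesis using \<alpha> \<beta> by (simp add: field_simps)
qed

text \<open>Applies \<open>collapse_by_levels\<close> with \<open>nu_star\<close> as the level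
  function; the support of the optimal matching is the face to be collapsed on each level. The
  condition on \<open>d\<close> reflects that its size is bounded by a strict inequality.\<close>

lemma generic_collapse:
  assumes r: "\<And>e. e \<in> E \<Longrightarrow> card e \<le> r"
    and \<alpha>: "0 < \<alpha>" "\<And>e. e \<in> E \<Longrightarrow> \<alpha> \<le> a e" and \<beta>: "0 < \<beta>" "\<And>v. v \<in> V \<Longrightarrow> \<beta> \<le> b v"
    and vertices: "\<And>f. indep_vertices (supp f) (tight b f)"
    and basic: "\<And>F f. F \<subseteq> E \<Longrightarrow> optimal a b F f \<Longrightarrow> f \<in> basic_matchings b"
    and distinct: "\<And>f g. f \<in> basic_matchings b \<Longrightarrow> g \<in> basic_matchings b \<Longrightarrow> val a f = val a g \<Longrightarrow> f = g"
    and n: "0 < n"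
    and d: "\<And>k. real k < real r * n / (\<alpha> * \<beta>) \<Longrightarrow> k \<le> d"
  defines "X \<equiv> {F. F \<subseteq> E \<and> nu_star V a b F < n}"
  shows "(elementary_collapse d)\<^sup>*\<^sup>* X {{}}"
proof (rule collapse_by_levels[where g = "nu_star V a b" and X = X])
  have bpos: "0 < b v" if "v \<in> V" for v using \<beta> that by force
  then have b: "0 \<le> b v" if "v \<in> V" for v using that less_imp_le by blast
  have apos: "0 < a e" if "e \<in> E" for e using \<alpha> that by force
  show "finite X" using finE by (simp add: X_def)
  show "finite F" if "F \<in> X" for F using that finE finite_subset by (auto simp: X_def)
  show "nu_star V a b F \<le> nu_star V a b G" if "F \<in> X" "G \<in> X" "F \<subseteq> G" for F G
    using that b by (intro nu_star_mono) (auto simp: X_def)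
  show "{} \<in> X" using n b by (simp add: X_def nu_star_empty)
  fix F assume FX: "F \<in> X" and ne: "F \<noteq> {}"
  have F: "F \<subseteq> E" "nu_star V a b F < n" using FX by (auto simp: X_def)
  obtain f where f: "optimal a b F f" using optimal_exists[OF F(1), of b a] b by auto
  have fb: "matching b E f" "indep_edges (supp f) (tight b f)"
    using basic[OF F(1) f] by (auto simp: basic_matchings_def)
  obtain w where w: "\<And>e. e \<in> supp f \<Longrightarrow> (\<Sum>v\<in>e. w v) = a e"
    "(\<Sum>v\<in>V. w v * b v) = val a f"
    "\<And>F v. F \<subseteq> E \<Longrightarrow> optimal a b F f \<Longrightarrow> 0 \<le> w v"
    "\<And>F e. F \<subseteq> E \<Longrightarrow> optimal a b F f \<Longrightarrow> e \<in> F \<Longrightarrow> a e \<le> (\<Sum>v\<in>e. w v)"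
    by (rule dual_certificate[of b f a, OF _ fb(2) vertices]) (use b in auto)
  \<comment> \<open>The largest set of edges for which \<open>w\<close> is still dual feasible,
    hence the top of the level.\<close>
  define T where "T = {e\<in>E. a e \<le> (\<Sum>v\<in>e. w v)}"
  have valf: "val a f = nu_star V a b F" using f by (simp add: optimal_def)
  \<comment> \<open>On the same level, genericity forces the same optimal matching \<open>f\<close>,
    and then \<open>w\<close> covers \<open>G\<close>. Conversely \<open>f\<close> is a matching on
    \<open>G\<close> and \<open>w\<close> a dual solution for it, so both bounds on
    \<open>nu_star\<close> coincide.\<close>
  have level: "nu_star V a b G = nu_star V a b F \<longleftrightarrow> supp f \<subseteq> G \<and> G \<subseteq> T" if G: "G \<subseteq> E" for G
  proof
    assume eq: "nu_star V a b G = nu_star V a b F"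
    obtain g where g: "optimal a b G g" using optimal_exists[OF G, of b a] b by auto
    have "g = f"
      using distinct basic[OF G g] basic[OF F(1) f] eq f g by (simp add: optimal_def)
    then have "optimal a b G f" using g by simp
    then show "supp f \<subseteq> G \<and> G \<subseteq> T"
      using w(4)[OF G] G by (auto simp: T_def optimal_def matching_def supp_def)
  next
    assume GT: "supp f \<subseteq> G \<and> G \<subseteq> T"
    then have "matching b G f" using fb by (auto simp: matching_def supp_def)
    then have "val a f \<le> nu_star V a b G" using b by (intro nu_star_ge[OF G])
    moreover have "nu_star V a b G \<le> (\<Sum>v\<in>V. w v * b v)"
      using GT w(3)[OF F(1) f] by (intro weak_duality[OF G b]) (auto simp: T_def)
    ultimately show "nu_star V a b G = nu_star V a b F" using w(2) valf by simp
  qed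
  have sE: "supp f \<subseteq> E" "T \<subseteq> E" "supp f \<subseteq> T" using w(1) by (auto simp: supp_def T_def)
  then have X: "supp f \<in> X" "T \<in> X"
    using level[of "supp f"] level[of T] F(2) by (auto simp: X_def)
  have "card (supp f) \<le> card (tight b f)"
    using sE fb by (intro indep_edges_solve) (auto simp: tight_def)
  also have "real (card (tight b f)) < real r * n / (\<alpha> * \<beta>)"
  proof -
    \<comment> \<open>An edge forces \<open>0 < r\<close>, so the strict inequality
      \<open>val a f < n\<close> survives multiplication by \<open>r\<close>.\<close>
    obtain e where "e \<in> E" using F ne by auto
    then have "0 < r" using r[of e] edge[of e] fin_edge[of e] by (metis card_gt_0_iff less_le_trans)
    then have "real r * val a f / (\<alpha> * \<beta>) < real r * n / (\<alpha> * \<beta>)"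
      using F(2) valf \<alpha> \<beta> by (intro divide_strict_right_mono mult_strict_left_mono) auto
    moreover have "real (card (tight b f)) \<le> real r * val a f / (\<alpha> * \<beta>)"
      using r fb(1) \<alpha> \<beta> by (rule card_tight_le)
    ultimately show ?thesis by linarith
  qed
  then have "card (tight b f) \<le> d" by (rule d)
  finally have "card (supp f) \<le> d" .
  moreover have "nu_star V a b {} < nu_star V a b F"
    using nu_star_pos[OF F(1) ne, of a b] apos bpos b by (simp add: nu_star_empty)
  ultimately show "nu_star V a b {} < nu_star V a b F \<and> (\<exists>\<sigma>\<in>X. \<exists>T\<in>X. card \<sigma> \<le> d \<and>
      (\<forall>G\<in>X. nu_star V a b G = nu_star V a b F \<longleftrightarrow> \<sigma> \<subseteq> G \<and> G \<subseteq> T))"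
    using X level by (auto simp: X_def intro!: bexI[of _ "supp f"] bexI[of _ T])
qed auto

section \<open>Passing from generic weights back to the given ones\<close>

lemma nu_star_mono_weights:
  assumes F: "F \<subseteq> E" and s: "0 < s" and b: "\<And>v. v \<in> V \<Longrightarrow> 0 \<le> b v"
    and a': "\<And>e. e \<in> E \<Longrightarrow> a' e \<le> s * a e"
    and b': "\<And>v. v \<in> V \<Longrightarrow> 0 \<le> b' v \<and> b' v \<le> s * b v"
  shows "nu_star V a' b' F \<le> s\<^sup>2 * nu_star V a b F"
proof -
  obtain f where f: "optimal a' b' F f" using optimal_exists[OF F, of b' a'] b' by auto
  \<comment> \<open>Dividing by \<open>s\<close> restores the bounds \<open>b\<close>. This costs
    one factor \<open>s\<close>, and replacing \<open>a'\<close> by \<open>a\<close> costs the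
    other.\<close>
  define g where "g e = f e / s" for e
  have "load g v = load f v / s" for v by (simp add: load_def g_def sum_divide_distrib)
  moreover have "load f v / s \<le> b v" if "v \<in> V" for v
  proof -
    have "load f v \<le> b' v" using f that by (simp add: optimal_def matching_def)
    also have "\<dots> \<le> s * b v" using b'[OF that] by simp
    finally show ?thesis using s by (simp add: field_simps)
  qed
  ultimately have "matching b F g"
    using f s by (simp add: optimal_def matching_def g_def)
  then have le: "val a g \<le> nu_star V a b F" using b by (intro nu_star_ge[OF F])
  have "nu_star V a' b' F = val a' f" using f by (simp add: optimal_def)
  also have "\<dots> \<le> (\<Sum>e\<in>E. (s * a e) * f e)"
    unfolding val_def using a' f by (intro sum_mono mult_right_mono) (auto simp: optimal_def matching_def)
  also have "\<dots> = s\<^sup>2 * val a g"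
    using s by (simp add: val_def g_def sum_distrib_left power2_eq_square algebra_simps)
  also have "\<dots> \<le> s\<^sup>2 * nu_star V a b F" using le by (intro mult_left_mono) auto
  finally show ?thesis .
qed

lemma collapse:
  assumes r: "\<And>e. e \<in> E \<Longrightarrow> card e \<le> r"
    and \<alpha>: "0 < \<alpha>" "\<And>e. e \<in> E \<Longrightarrow> \<alpha> \<le> a e" and \<beta>: "0 < \<beta>" "\<And>v. v \<in> V \<Longrightarrow> \<beta> \<le> b v"
    and n: "0 < n" and d: "\<And>k. real k < real r * n / (\<alpha> * \<beta>) \<Longrightarrow> k \<le> d"
  defines "X \<equiv> {F. F \<subseteq> E \<and> nu_star V a b F < n}"
  shows "(elementary_collapse d)\<^sup>*\<^sup>* X {{}}"
proof -
  have bpos: "0 < b v" if "v \<in> V" for v using \<beta> that by force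
  then have b: "0 \<le> b v" if "v \<in> V" for v using that less_imp_le by blast
  have apos: "0 < a e" if "e \<in> E" for e using \<alpha> that by force
  have "eventually (\<lambda>s. s\<^sup>2 * nu_star V a b F < n) (at_right 1)" if "F \<in> X" for F
  proof -
    have "((\<lambda>s. s\<^sup>2 * nu_star V a b F) \<longlongrightarrow> 1\<^sup>2 * nu_star V a b F) (at_right 1)"
      by (intro tendsto_intros)
    then show ?thesis using that by (intro order_tendstoD(2)) (auto simp: X_def)
  qed
  moreover have "finite X" using finE by (simp add: X_def)
  \<comment> \<open>The inequalities defining the finitely many faces are strict, so a common factor
    \<open>s > 1\<close> is affordable. The weights are then chosen generically between the given
    ones and \<open>s\<close> times them.\<close>
  ultimately have "eventually (\<lambda>s. (\<forall>F\<in>X. s\<^sup>2 * nu_star V a b F < n) \<and> 1 < s) (at_right 1)"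
    by (intro eventually_conj eventually_ball_finite) (auto simp: eventually_at_right_less)
  then obtain s where s: "\<And>F. F \<in> X \<Longrightarrow> s\<^sup>2 * nu_star V a b F < n" "1 < s"
    using eventually_happens'[OF trivial_limit_at_right_real] by blast
  obtain b' where b': "\<And>v. v \<in> V \<Longrightarrow> b v \<le> b' v \<and> b' v < s * b v"
    and vertices: "\<And>f. indep_vertices (supp f) (tight b' f)"
    using generic_vertex_weights[of b "\<lambda>v. s * b v"] bpos s by auto
  have b'0: "0 \<le> b' v" if "v \<in> V" for v using b'[OF that] b[OF that] by linarith
  obtain a' where a': "\<And>e. e \<in> E \<Longrightarrow> a e \<le> a' e \<and> a' e < s * a e"
    and basic: "\<And>F f. F \<subseteq> E \<Longrightarrow> optimal a' b' F f \<Longrightarrow> f \<in> basic_matchings b'"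
    and distinct: "\<And>f g. f \<in> basic_matchings b' \<Longrightarrow> g \<in> basic_matchings b' \<Longrightarrow> val a' f = val a' g \<Longrightarrow> f = g"
    using generic_edge_weights[of a "\<lambda>e. s * a e" b'] apos s b'0 by auto
  have "nu_star V a b F < n \<longleftrightarrow> nu_star V a' b' F < n" if F: "F \<subseteq> E" for F
  proof
    assume "nu_star V a b F < n"
    then have "s\<^sup>2 * nu_star V a b F < n" using s F by (simp add: X_def)
    moreover have "nu_star V a' b' F \<le> s\<^sup>2 * nu_star V a b F"
      using F s a' b' b b'0 by (intro nu_star_mono_weights) (auto intro: less_imp_le)
    ultimately show "nu_star V a' b' F < n" by simp
  next
    assume "nu_star V a' b' F < n"
    \<comment> \<open>The case \<open>s = 1\<close>: raising the weights does not decrease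
      \<open>nu_star\<close>, so no new face appears.\<close>
    moreover have "nu_star V a b F \<le> 1\<^sup>2 * nu_star V a' b' F"
      using F a' b' b b'0 by (intro nu_star_mono_weights) auto
    ultimately show "nu_star V a b F < n" by simp
  qed
  then have "X = {F. F \<subseteq> E \<and> nu_star V a' b' F < n}" by (auto simp: X_def)
  moreover have "\<alpha> \<le> a' e" if "e \<in> E" for e using a'[OF that] \<alpha>(2)[OF that] by linarith
  moreover have "\<beta> \<le> b' v" if "v \<in> V" for v using b'[OF that] \<beta>(2)[OF that] by linarith
  ultimately show ?thesis
    using generic_collapse[of r \<alpha> a' \<beta> b' n d] r \<alpha>(1) \<beta>(1) vertices basic distinct n d by simp
qed

end

theorem theorem12:
  fixes V :: "'v set" and E :: "'v set set"
    and a :: "'v set \<Rightarrow> real" and b :: "'v \<Rightarrow> real"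
    and r :: nat and n :: real
  assumes "2 \<le> r"
    and "uniform_hypergraph r V E" and "E \<noteq> {}"
    and "\<And>e. e \<in> E \<Longrightarrow> 0 < a e" and "\<And>v. v \<in> V \<Longrightarrow> 0 < b v"
    and "Min (a ` E) * Min (b ` V) < n"
  shows "collapsible (nat (\<lceil>real r * n / (Min (a ` E) * Min (b ` V))\<rceil> - 1))
           {F. F \<subseteq> E \<and> nu_star V a b F < n}"
proof -
  interpret finite_hypergraph V E
    using assms(1,2) by unfold_locales (auto simp: uniform_hypergraph_def)
  define \<alpha> where "\<alpha> = Min (a ` E)"
  define \<beta> where "\<beta> = Min (b ` V)"
  have "V \<noteq> {}" using edge assms(3) by blast
  then have pos: "0 < \<alpha>" "0 < \<beta>"
    using assms(3-5) finE finV by (auto simp: \<alpha>_def \<beta>_def)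
  have le: "\<alpha> \<le> a e" "\<beta> \<le> b v" if "e \<in> E" "v \<in> V" for e v
    using that finE finV by (auto simp: \<alpha>_def \<beta>_def)
  have n: "0 < n" using assms(6) pos by (simp add: \<alpha>_def \<beta>_def) (meson less_trans mult_pos_pos)
  \<comment> \<open>For positive \<open>x\<close>, the ceiling minus one is the largest integer
    strictly below \<open>x\<close>, so the strict bound on the size of the collapsed face yields
    the stated dimension.\<close>
  have d: "k \<le> nat (\<lceil>x\<rceil> - 1)" if "real k < x" for k x
    using that by linarith
  have "simplicial_complex {F. F \<subseteq> E \<and> nu_star V a b F < n}"
    unfolding simplicial_complex_def
  proof (intro ballI allI impI)
    fix \<sigma> \<tau> assume \<sigma>: "\<sigma> \<in> {F. F \<subseteq> E \<and> nu_star V a b F < n}" and sub: "\<tau> \<subseteq> \<sigma>"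
    have "nu_star V a b \<tau> \<le> nu_star V a b \<sigma>"
      using \<sigma> sub assms(5) by (intro nu_star_mono) (auto intro: less_imp_le)
    then show "\<tau> \<in> {F. F \<subseteq> E \<and> nu_star V a b F < n}" using \<sigma> sub by auto
  qed
  moreover have "(elementary_collapse (nat (\<lceil>real r * n / (\<alpha> * \<beta>)\<rceil> - 1)))\<^sup>*\<^sup>*
      {F. F \<subseteq> E \<and> nu_star V a b F < n} {{}}"
    using assms(2) le pos n d \<open>V \<noteq> {}\<close> assms(3)
    by (intro collapse[of r \<alpha> a \<beta> b n]) (auto simp: uniform_hypergraph_def)
  ultimately show ?thesis by (simp add: collapsible_def \<alpha>_def \<beta>_def)
qed

end
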